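(* Let $n\ge 1$ and let $d_\boxplus:\mathbb R^n\times\mathbb R^n\to\mathbb R_+$ be defined by $d_\boxplus(x,y)=\max_{i\in[n]}|x_i\boxminus y_i|$. Then $d_\boxplus$ defines an ultrametric on $\mathbb R^n$, that is, for all $x,y,z\in\mathbb R^n$: (1) $d_\boxplus(x,y)=d_\boxplus(y,x)$; (2) $d_\boxplus(x,y)=0$ if and only if $x=y$; (3) $d_\boxplus(x,y)\le\max\{d_\boxplus(x,z),d_\boxplus(z,y)\}$.
   Context: Notation: $[n]=\{1,\dots,n\}$. For $\lambda,\mu\in\mathbb R$, $\lambda\boxplus\mu=\lambda$ if $|\lambda|>|\mu|$, $\lambda\boxplus\mu=\frac12(\lambda+\mu)$ if $|\lambda|=|\mu|$, and $\lambda\boxplus\mu=\mu$ if $|\lambda|<|\mu|$. Moreover $\lambda\boxminus\mu=\lambda\boxplus(-\mu)$. *)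

theory Defs
  imports "HOL-Analysis.Analysis"
begin

definition boxplus :: "real \<Rightarrow> real \<Rightarrow> real"  (infixl "\<boxplus>" 65) where
  "a \<boxplus> b = (if \<bar>a\<bar> > \<bar>b\<bar> then a else if \<bar>a\<bar> = \<bar>b\<bar> then (1/2) * (a + b) else b)"

definition boxminus :: "real \<Rightarrow> real \<Rightarrow> real"  (infixl "\<boxminus>" 65) where
  "a \<boxminus> b = a \<boxplus> (- b)"

text \<open>The index type \<open>'n\<close> is finite and nonempty, so the maximum ranges over a finite nonempty set.\<close>

definition d_box :: "real ^ 'n \<Rightarrow> real ^ 'n \<Rightarrow> real" where
  "d_box x y = (MAX i\<in>UNIV. \<bar>x $ i \<boxminus> y $ i\<bar>)"

end

theory Submission
  imports Defs
begin

text \<open>On the line the distance of two distinct points is the larger of their absolute values, which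
  is an ultrametric; a maximum of finitely many ultrametrics inherits all the properties.\<close>

text \<open>In the tie \<open>\<bar>a\<bar> = \<bar>b\<bar>\<close> the average
  \<open>(a - b) / 2\<close> is 0 for \<open>b = a\<close> and \<open>a\<close> for
  \<open>b = - a\<close>.\<close>

lemma abs_boxminus: "\<bar>a \<boxminus> b\<bar> = (if a = b then 0 else max \<bar>a\<bar> \<bar>b\<bar>)"
  by (auto simp: boxminus_def boxplus_def abs_if split: if_splits)

lemma abs_boxminus_commute: "\<bar>a \<boxminus> b\<bar> = \<bar>b \<boxminus> a\<bar>"
  by (simp add: abs_boxminus max.commute)

lemma abs_boxminus_eq_0_iff: "\<bar>a \<boxminus> b\<bar> = 0 \<longleftrightarrow> a = b"
  unfolding abs_boxminus by (auto simp: max_def)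

text \<open>For \<open>a \<noteq> b\<close>, the point \<open>c\<close> differs from one of them. If
  \<open>c\<close> equals the other, one term on the right is already
  \<open>max \<bar>a\<bar> \<bar>b\<bar>\<close>; otherwise the two terms dominate
  \<open>\<bar>a\<bar>\<close> and \<open>\<bar>b\<bar>\<close> respectively.\<close>

lemma abs_boxminus_ultrametric: "\<bar>a \<boxminus> b\<bar> \<le> max \<bar>a \<boxminus> c\<bar> \<bar>c \<boxminus> b\<bar>"
  unfolding abs_boxminus by (auto simp: le_max_iff_disj)

lemma d_box_le_iff: "d_box x y \<le> r \<longleftrightarrow> (\<forall>i. \<bar>x $ i \<boxminus> y $ i\<bar> \<le> r)"
  by (simp add: d_box_def)

lemma abs_boxminus_le_d_box: "\<bar>x $ i \<boxminus> y $ i\<bar> \<le> d_box x y"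
  using d_box_le_iff by blast

lemma d_box_nonneg: "0 \<le> d_box x y"
  using abs_boxminus_le_d_box[of x _ y] abs_ge_zero order_trans by blast

lemma d_box_commute: "d_box x y = d_box y x"
  unfolding d_box_def by (simp only: abs_boxminus_commute)

lemma d_box_eq_0_iff: "d_box x y = 0 \<longleftrightarrow> x = y"
proof -
  \<comment> \<open>As an upper bound, the equation can be checked coordinatewise by
    \<open>d_box_le_iff\<close>.\<close>
  have "d_box x y = 0 \<longleftrightarrow> d_box x y \<le> 0"
    using d_box_nonneg[of x y] by linarith
  also have "\<dots> \<longleftrightarrow> (\<forall>i. x $ i = y $ i)"
    unfolding d_box_le_iff abs_le_zero_iff using abs_boxminus_eq_0_iff by simp
  finally show ?thesis
    by (simp add: vec_eq_iff)
qed

lemma d_box_ultrametric: "d_box x y \<le> max (d_box x z) (d_box z y)"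
  unfolding d_box_le_iff
  \<comment> \<open>Each coordinate satisfies the inequality on the line, whose two terms are
    bounded by the distances.\<close>
  by (meson abs_boxminus_ultrametric abs_boxminus_le_d_box max.mono order_trans)

theorem proposition2p2p3:
  shows "(\<forall>x y :: real ^ 'n. 0 \<le> d_box x y) \<and>
         (\<forall>x y :: real ^ 'n. d_box x y = d_box y x) \<and>
         (\<forall>x y :: real ^ 'n. d_box x y = 0 \<longleftrightarrow> x = y) \<and>
         (\<forall>x y z :: real ^ 'n. d_box x y \<le> max (d_box x z) (d_box z y))"
  using d_box_nonneg d_box_commute d_box_eq_0_iff d_box_ultrametric by blast

end
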